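(* Let $\Phi$ be a finite irreducible crystallographic root system with Weyl group $W$, standard positive system $\Phi^+$ and simple system $\Delta$, and let $\Delta_2\subset\Delta$. The biclosed sets in $\Phi^+_{\emptyset,\Delta_2}$ are in bijection with the biclosed sets in $\Phi$ whose stabilizer in $W$ is contained in $W_{\Delta_2}$, the parabolic subgroup of $W$ generated by $s_\alpha$, $\alpha\in\Delta_2$. More specifically, to a biclosed set $C$ in $\Phi^+_{\emptyset,\Delta_2}$ one associates the biclosed set (in $\Phi$) $$(C\cap \Phi_{\Delta_2})\cup(C\cap \Phi^+_{\Delta_2,\emptyset})\cup -\bigl(\Phi^+_{\Delta_2,\emptyset}\setminus (\Phi^+_{\Delta_2,\emptyset}\cap C)\bigr),$$ and conversely, to a biclosed set $F$ in $\Phi$ (with stabilizer contained in $W_{\Delta_2}$) one associates the biclosed set $F\cap \Phi^+_{\emptyset,\Delta_2}$ in $\Phi^+_{\emptyset,\Delta_2}$.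
   Context: A subset $C\subset\Phi$ is closed if $\alpha,\beta\in C$ and $\alpha+\beta\in\Phi$ imply $\alpha+\beta\in C$. For $D\subset\Phi$, a biclosed set in $D$ is a closed set $B\subset D$ such that $D\setminus B$ is also closed. For $\Delta'\subset\Delta$: $\Phi_{\Delta'}=\mathrm{span}_{\mathbb R}(\Delta')\cap\Phi$; $\Phi^+_{\emptyset,\Delta'}=\Phi^+\cup\Phi_{\Delta'}$ (a standard parabolic subset); $\Phi^+_{\Delta',\emptyset}=\Phi^+\setminus\Phi_{\Delta'}$. $W$ acts on subsets of $\Phi$ by $E\mapsto w(E)$, and the stabilizer of $E$ is $\{w\in W: w(E)=E\}$. $s_\alpha$ denotes the reflection in the root $\alpha$. *)

theory Defs
  imports "HOL-Analysis.Analysis" "HOL-Algebra.Bij" "HOL-Algebra.Generated_Groups"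
begin

definition reflection :: "'a::euclidean_space \<Rightarrow> 'a \<Rightarrow> 'a" where
  "reflection \<alpha> v = v - (2 * (v \<bullet> \<alpha>) / (\<alpha> \<bullet> \<alpha>)) *\<^sub>R \<alpha>"

text \<open>Finite crystallographic root systems; following the usual convention they are reduced.\<close>

definition root_system :: "'a::euclidean_space set \<Rightarrow> bool" where
  "root_system \<Phi> \<longleftrightarrow>
     finite \<Phi> \<and> span \<Phi> = UNIV \<and> 0 \<notin> \<Phi> \<and>
     (\<forall>\<alpha>\<in>\<Phi>. \<forall>c. c *\<^sub>R \<alpha> \<in> \<Phi> \<longrightarrow> c = 1 \<or> c = -1) \<and>
     (\<forall>\<alpha>\<in>\<Phi>. reflection \<alpha> ` \<Phi> = \<Phi>) \<and>
     (\<forall>\<alpha>\<in>\<Phi>. \<forall>\<beta>\<in>\<Phi>. 2 * (\<beta> \<bullet> \<alpha>) / (\<alpha> \<bullet> \<alpha>) \<in> \<int>)"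

definition irreducible_root_system :: "'a::euclidean_space set \<Rightarrow> bool" where
  "irreducible_root_system \<Phi> \<longleftrightarrow>
     root_system \<Phi> \<and> \<Phi> \<noteq> {} \<and>
     \<not> (\<exists>\<Phi>\<^sub>1 \<Phi>\<^sub>2. \<Phi>\<^sub>1 \<noteq> {} \<and> \<Phi>\<^sub>2 \<noteq> {} \<and> \<Phi>\<^sub>1 \<union> \<Phi>\<^sub>2 = \<Phi> \<and>
            (\<forall>\<alpha>\<in>\<Phi>\<^sub>1. \<forall>\<beta>\<in>\<Phi>\<^sub>2. \<alpha> \<bullet> \<beta> = 0))"

definition positive_roots :: "'a::euclidean_space set \<Rightarrow> 'a set \<Rightarrow> 'a set" where
  "positive_roots \<Phi> \<Delta> = {\<alpha> \<in> \<Phi>. \<exists>c :: 'a \<Rightarrow> nat. \<alpha> = (\<Sum>\<delta>\<in>\<Delta>. real (c \<delta>) *\<^sub>R \<delta>)}"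

definition simple_system :: "'a::euclidean_space set \<Rightarrow> 'a set \<Rightarrow> bool" where
  "simple_system \<Phi> \<Delta> \<longleftrightarrow>
     \<Delta> \<subseteq> \<Phi> \<and> independent \<Delta> \<and>
     (\<forall>\<alpha>\<in>\<Phi>. \<alpha> \<in> positive_roots \<Phi> \<Delta> \<or> - \<alpha> \<in> positive_roots \<Phi> \<Delta>)"

text \<open>The group operation of \<^term>\<open>BijGroup UNIV\<close> is composition of maps.\<close>

definition reflection_group :: "'a::euclidean_space set \<Rightarrow> ('a \<Rightarrow> 'a) set" where
  "reflection_group S = generate (BijGroup UNIV) (reflection ` S)"

abbreviation weyl_group :: "'a::euclidean_space set \<Rightarrow> ('a \<Rightarrow> 'a) set" where
  "weyl_group \<Phi> \<equiv> reflection_group \<Phi>"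

abbreviation parabolic_subgroup :: "'a::euclidean_space set \<Rightarrow> ('a \<Rightarrow> 'a) set" where
  "parabolic_subgroup \<Delta>' \<equiv> reflection_group \<Delta>'"

definition set_stabilizer :: "'a::euclidean_space set \<Rightarrow> 'a set \<Rightarrow> ('a \<Rightarrow> 'a) set" where
  "set_stabilizer \<Phi> E = {w \<in> weyl_group \<Phi>. w ` E = E}"

text \<open>Closedness under addition in \<open>\<Phi>\<close>, not topological closedness.\<close>

definition root_closed :: "'a::euclidean_space set \<Rightarrow> 'a set \<Rightarrow> bool" where
  "root_closed \<Phi> C \<longleftrightarrow>
     C \<subseteq> \<Phi> \<and> (\<forall>\<alpha>\<in>C. \<forall>\<beta>\<in>C. \<alpha> + \<beta> \<in> \<Phi> \<longrightarrow> \<alpha> + \<beta> \<in> C)"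

definition biclosed_in :: "'a::euclidean_space set \<Rightarrow> 'a set \<Rightarrow> 'a set \<Rightarrow> bool" where
  "biclosed_in \<Phi> D B \<longleftrightarrow> B \<subseteq> D \<and> root_closed \<Phi> B \<and> root_closed \<Phi> (D - B)"

definition root_subsystem :: "'a::euclidean_space set \<Rightarrow> 'a set \<Rightarrow> 'a set" where
  "root_subsystem \<Phi> \<Delta>' = span \<Delta>' \<inter> \<Phi>"

text \<open>The next two sets are \<open>\<Phi>\<^sup>+\<^bsub>\<emptyset>,\<Delta>'\<^esub>\<close> and \<open>\<Phi>\<^sup>+\<^bsub>\<Delta>',\<emptyset>\<^esub>\<close>.\<close>

definition standard_parabolic :: "'a::euclidean_space set \<Rightarrow> 'a set \<Rightarrow> 'a set \<Rightarrow> 'a set" where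
  "standard_parabolic \<Phi> \<Delta> \<Delta>' = positive_roots \<Phi> \<Delta> \<union> root_subsystem \<Phi> \<Delta>'"

definition parabolic_radical :: "'a::euclidean_space set \<Rightarrow> 'a set \<Rightarrow> 'a set \<Rightarrow> 'a set" where
  "parabolic_radical \<Phi> \<Delta> \<Delta>' = positive_roots \<Phi> \<Delta> - root_subsystem \<Phi> \<Delta>'"

text \<open>The negative of a set is written \<open>uminus ` S\<close>, as \<open>- S\<close> denotes the complement.\<close>

definition biclosed_extension ::
    "'a::euclidean_space set \<Rightarrow> 'a set \<Rightarrow> 'a set \<Rightarrow> 'a set \<Rightarrow> 'a set" where
  "biclosed_extension \<Phi> \<Delta> \<Delta>' C =
     (C \<inter> root_subsystem \<Phi> \<Delta>') \<union> (C \<inter> parabolic_radical \<Phi> \<Delta> \<Delta>') \<union>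
     uminus ` (parabolic_radical \<Phi> \<Delta> \<Delta>' - (parabolic_radical \<Phi> \<Delta> \<Delta>' \<inter> C))"

end

theory Submission
  imports Defs
begin

text \<open>
  Write \<open>R\<close> for the radical and \<open>\<Phi>\<^sub>2\<close> for the roots in the span of \<open>\<Delta>\<^sub>2\<close>, so that \<open>\<Phi>\<close> is the
  disjoint union of \<open>\<Phi>\<^sub>2\<close>, \<open>R\<close> and \<open>-R\<close>.  For a biclosed set \<open>F\<close> in \<open>\<Phi>\<close> let \<open>\<Psi>\<close> be the set of roots
  \<open>\<alpha>\<close> such that \<open>\<alpha>\<close> and \<open>-\<alpha>\<close> are both in \<open>F\<close> or both outside \<open>F\<close>.  Root strings show that \<open>s\<^sub>\<alpha>\<close>
  stabilizes \<open>F\<close> for \<open>\<alpha> \<in> \<Psi>\<close>; so if the stabilizer lies in the parabolic subgroup, then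
  \<open>\<Psi> \<subseteq> \<Phi>\<^sub>2\<close>, and \<open>F\<close> is determined by its intersection with the parabolic subset.

  Conversely, the stabilizer of \<open>F\<close> is generated by the \<open>s\<^sub>\<alpha>\<close>, \<open>\<alpha> \<in> \<Psi>\<close>.  Some positive system \<open>\<Pi>\<close> is
  contained in the closed set \<open>G = F \<union> -(\<Phi> - F)\<close>, and \<open>G\<close> is preserved by every \<open>w\<close> stabilizing \<open>F\<close>.
  If \<open>w\<Pi> \<noteq> \<Pi>\<close>, some simple root \<open>\<alpha>\<close> of \<open>\<Pi>\<close> has \<open>-\<alpha> \<in> w\<Pi> \<subseteq> G\<close>; hence \<open>\<alpha> \<in> \<Psi>\<close>, and \<open>s\<^sub>\<alpha>w\<close>
  makes fewer elements of \<open>\<Pi>\<close> negative.  If \<open>w\<Pi> = \<Pi>\<close>, then \<open>w = 1\<close> by the exchange condition.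
\<close>

section \<open>Reflections and the groups they generate\<close>

lemma linear_reflection: "linear (reflection \<alpha>)"
  by (rule linearI) (auto simp: reflection_def algebra_simps inner_add_left add_divide_distrib)

lemmas reflection_simps =
  linear_add[OF linear_reflection] linear_diff[OF linear_reflection]
  linear_neg[OF linear_reflection] linear_cmul[OF linear_reflection]

lemma reflection_self: "reflection \<alpha> \<alpha> = - \<alpha>"
  by (cases "\<alpha> = 0") (auto simp: reflection_def scaleR_2)

lemma reflection_reflection [simp]: "reflection \<alpha> (reflection \<alpha> v) = v"
proof -
  have "reflection \<alpha> (reflection \<alpha> v) = reflection \<alpha> (v - (2 * (v \<bullet> \<alpha>) / (\<alpha> \<bullet> \<alpha>)) *\<^sub>R \<alpha>)"
    by (simp add: reflection_def[of \<alpha> v])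
  also have "\<dots> = reflection \<alpha> v + (2 * (v \<bullet> \<alpha>) / (\<alpha> \<bullet> \<alpha>)) *\<^sub>R \<alpha>"
    by (simp only: reflection_simps reflection_self) simp
  also have "\<dots> = v" by (simp add: reflection_def)
  finally show ?thesis .
qed

lemma reflection_comp_self [simp]: "reflection \<alpha> \<circ> reflection \<alpha> = id"
  by (simp add: fun_eq_iff)

lemma bij_reflection: "bij (reflection \<alpha>)"
  by (rule o_bij[of "reflection \<alpha>"]) simp_all

lemma inj_reflection: "inj (reflection \<alpha>)"
  using bij_reflection bij_is_inj by blast

lemma reflection_image_image [simp]: "reflection \<alpha> ` reflection \<alpha> ` S = S"
  by (simp add: image_comp)

lemma reflection_uminus [simp]: "reflection (- \<alpha>) = reflection \<alpha>"
  by (simp add: fun_eq_iff reflection_def)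

lemma inner_reflection [simp]: "reflection \<alpha> u \<bullet> reflection \<alpha> v = u \<bullet> v"
proof (cases "\<alpha> = 0")
  case False
  then have "\<alpha> \<bullet> \<alpha> \<noteq> 0" by simp
  then show ?thesis
    by (simp add: reflection_def inner_diff_left inner_diff_right inner_commute field_simps)
qed (simp add: reflection_def)

text \<open>The reflection in \<alpha> is an isometry and an involution, so pairing v with the image
  of \<beta> amounts to pairing the image of v with \<beta>.\<close>

lemma reflection_conj:
  "reflection (reflection \<alpha> \<beta>) = reflection \<alpha> \<circ> reflection \<beta> \<circ> reflection \<alpha>"
proof
  fix v
  have "v \<bullet> reflection \<alpha> \<beta> = reflection \<alpha> v \<bullet> \<beta>"
    using inner_reflection[of \<alpha> "reflection \<alpha> v" \<beta>] by simp
  then show "reflection (reflection \<alpha> \<beta>) v = (reflection \<alpha> \<circ> reflection \<beta> \<circ> reflection \<alpha>) v"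
    unfolding o_def reflection_def[of \<beta>] reflection_def[of "reflection \<alpha> \<beta>"]
    by (simp add: reflection_simps)
qed

section \<open>Words in reflections and the groups they generate\<close>

definition reflection_word :: "'a::euclidean_space list \<Rightarrow> 'a \<Rightarrow> 'a" where
  "reflection_word as = foldr (\<lambda>\<alpha> f. reflection \<alpha> \<circ> f) as id"

lemma reflection_word_Nil [simp]: "reflection_word [] = id"
  and reflection_word_Cons [simp]:
    "reflection_word (\<alpha> # as) = reflection \<alpha> \<circ> reflection_word as"
  by (simp_all add: reflection_word_def)

lemma reflection_word_append [simp]:
  "reflection_word (as @ bs) = reflection_word as \<circ> reflection_word bs"
  by (induction as) (simp_all add: comp_assoc)

lemma reflection_word_conj:
  "reflection (reflection_word as \<alpha>) (reflection_word as v) = reflection_word as (reflection \<alpha> v)"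
  by (induction as) (simp_all add: reflection_conj)

lemma mult_BijGroup_UNIV:
  assumes "bij f" "bij g"
  shows "f \<otimes>\<^bsub>BijGroup UNIV\<^esub> g = f \<circ> g"
  using assms by (simp add: BijGroup_def Bij_def compose_def fun_eq_iff)

lemma inv_BijGroup_reflection: "inv\<^bsub>BijGroup UNIV\<^esub> (reflection \<alpha>) = reflection \<alpha>"
proof -
  have "reflection \<alpha> \<in> Bij UNIV"
    using bij_reflection[of \<alpha>] by (simp add: Bij_def)
  moreover have "inv_into UNIV (reflection \<alpha>) = reflection \<alpha>"
    by (rule inv_equality) simp_all
  ultimately show ?thesis
    by (simp add: inv_BijGroup restrict_def)
qed

lemma bij_reflection_word: "bij (reflection_word as)"
proof (induction as)
  case Nil
  show ?case unfolding reflection_word_Nil by (rule bij_id)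
next
  case (Cons \<alpha> as)
  then show ?case unfolding reflection_word_Cons by (intro bij_comp bij_reflection)
qed

text \<open>Reflections are their own inverses, so the inverse of a generator is again a one-letter
  word. Words provide what \<open>generate\<close> hides: induction along the letters and a length
  to minimize.\<close>

lemma reflection_group_eq: "reflection_group S = reflection_word ` lists S"
proof
  show "reflection_group S \<subseteq> reflection_word ` lists S"
  proof
    fix w assume "w \<in> reflection_group S"
    then have "w \<in> generate (BijGroup UNIV) (reflection ` S)" by (simp add: reflection_group_def)
    then show "w \<in> reflection_word ` lists S"
    proof induction
      case one
      have "\<one>\<^bsub>BijGroup UNIV\<^esub> = (reflection_word [] :: 'a \<Rightarrow> 'a)"
        by (simp add: BijGroup_def fun_eq_iff)
      then show ?case by (metis imageI lists.Nil)
    next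
      case (incl h)
      then obtain \<alpha> where "[\<alpha>] \<in> lists S" "h = reflection_word [\<alpha>]" by auto
      then show ?case by blast
    next
      case (inv h)
      then obtain \<alpha> where "[\<alpha>] \<in> lists S" "inv\<^bsub>BijGroup UNIV\<^esub> h = reflection_word [\<alpha>]"
        by (auto simp: inv_BijGroup_reflection)
      then show ?case by (metis imageI)
    next
      case (eng g h)
      then obtain as bs where "as \<in> lists S" "bs \<in> lists S"
        "g = reflection_word as" "h = reflection_word bs" by auto
      then have "g \<otimes>\<^bsub>BijGroup UNIV\<^esub> h = reflection_word (as @ bs)" "as @ bs \<in> lists S"
        by (auto simp: mult_BijGroup_UNIV bij_reflection_word)
      then show ?case by blast
    qed
  qed
next
  show "reflection_word ` lists S \<subseteq> reflection_group S"
  proof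
    fix w assume "w \<in> reflection_word ` lists S"
    then obtain as where "as \<in> lists S" and w: "w = reflection_word as" by blast
    from this(1) show "w \<in> reflection_group S"
      unfolding w
    proof induction
      case Nil
      have "\<one>\<^bsub>BijGroup UNIV\<^esub> = (reflection_word [] :: 'a \<Rightarrow> 'a)"
        by (simp add: BijGroup_def fun_eq_iff)
      then show ?case unfolding reflection_group_def by (metis generate.one)
    next
      case (Cons \<alpha> as)
      then have "reflection \<alpha> \<otimes>\<^bsub>BijGroup UNIV\<^esub> reflection_word as \<in> reflection_group S"
        unfolding reflection_group_def by (auto intro: generate.eng generate.incl)
      then show ?case
        unfolding reflection_word_Cons mult_BijGroup_UNIV[OF bij_reflection bij_reflection_word] .
    qed
  qed
qed

lemma id_in_reflection_group: "id \<in> reflection_group S"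
  unfolding reflection_group_eq by (rule image_eqI[of _ _ "[]"]) simp_all

lemma reflection_in_group: "\<alpha> \<in> S \<Longrightarrow> reflection \<alpha> \<in> reflection_group S"
  unfolding reflection_group_eq by (rule image_eqI[of _ _ "[\<alpha>]"]) simp_all

lemma reflection_group_comp:
  assumes "f \<in> reflection_group S" "g \<in> reflection_group S"
  shows "f \<circ> g \<in> reflection_group S"
proof -
  obtain as bs where "f = reflection_word as" "g = reflection_word bs" "as \<in> lists S" "bs \<in> lists S"
    using assms unfolding reflection_group_eq by auto
  then have "f \<circ> g = reflection_word (as @ bs)" "as @ bs \<in> lists S" by auto
  then show ?thesis unfolding reflection_group_eq by blast
qed

lemma reflection_group_induct [consumes 1, case_names id comp]:
  assumes "w \<in> reflection_group S"
    and "P id"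
    and "\<And>\<alpha> w. \<alpha> \<in> S \<Longrightarrow> w \<in> reflection_group S \<Longrightarrow> P w \<Longrightarrow> P (reflection \<alpha> \<circ> w)"
  shows "P w"
proof -
  have "P (reflection_word as)" if "as \<in> lists S" for as
    using that
  proof induction
    case (Cons \<alpha> as)
    then have "reflection_word as \<in> reflection_group S" by (auto simp: reflection_group_eq)
    with Cons show ?case unfolding reflection_word_Cons by (intro assms(3))
  next
    case Nil
    show ?case unfolding reflection_word_Nil by (rule assms(2))
  qed
  then show ?thesis using assms(1) by (auto simp: reflection_group_eq)
qed

lemma reflection_group_subset:
  assumes "reflection ` S \<subseteq> reflection_group T"
  shows "reflection_group S \<subseteq> reflection_group T"
proof
  fix w assume "w \<in> reflection_group S"
  then show "w \<in> reflection_group T"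
  proof (induction rule: reflection_group_induct)
    case id
    show ?case by (rule id_in_reflection_group)
  next
    case (comp \<alpha> w)
    then show ?case using assms by (intro reflection_group_comp) auto
  qed
qed

lemma reflection_group_linear: "w \<in> reflection_group S \<Longrightarrow> linear w"
proof (induction rule: reflection_group_induct)
  case id
  show ?case by (rule linear_id)
next
  case (comp \<alpha> w)
  then show ?case by (intro linear_compose linear_reflection)
qed

lemma reflection_group_bij: "w \<in> reflection_group S \<Longrightarrow> bij w"
  using bij_reflection_word by (auto simp: reflection_group_eq)

text \<open>A reflection changes a vector by a multiple of its root, and these changes accumulate
  inside the span.\<close>

lemma reflection_group_diff_in_span:
  assumes "w \<in> reflection_group S"
  shows "w v - v \<in> span S"
  using assms
proof (induction rule: reflection_group_induct)
  case id
  then show ?case by (simp add: span_zero)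
next
  case (comp \<alpha> w)
  have "reflection \<alpha> (w v) - v = (w v - v) - (2 * (w v \<bullet> \<alpha>) / (\<alpha> \<bullet> \<alpha>)) *\<^sub>R \<alpha>"
    by (simp add: reflection_def)
  moreover have "(w v - v) - (2 * (w v \<bullet> \<alpha>) / (\<alpha> \<bullet> \<alpha>)) *\<^sub>R \<alpha> \<in> span S"
    using comp by (intro span_diff[OF comp.IH span_scale] span_base)
  ultimately show ?case unfolding o_apply by metis
qed

text \<open>The reflection moves \<alpha> by -2 \<alpha>. In this way the hypothesis that a
  stabilizer lies in a parabolic subgroup becomes a statement about spans.\<close>

lemma root_in_span_if_reflection_in_group:
  assumes "reflection \<alpha> \<in> reflection_group S"
  shows "\<alpha> \<in> span S"
proof -
  have "(-1/2) *\<^sub>R (reflection \<alpha> \<alpha> - \<alpha>) \<in> span S"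
    by (intro span_scale reflection_group_diff_in_span assms)
  moreover have "(-1/2) *\<^sub>R (reflection \<alpha> \<alpha> - \<alpha>) = \<alpha>"
  proof -
    have "reflection \<alpha> \<alpha> - \<alpha> = (-2) *\<^sub>R \<alpha>" by (simp add: reflection_self scaleR_2)
    then show ?thesis by simp
  qed
  ultimately show ?thesis by simp
qed

section \<open>Root systems\<close>

locale finite_root_system =
  fixes \<Phi> :: "'a::euclidean_space set"
  assumes root_system: "root_system \<Phi>"
begin

lemma finite_roots [simp]: "finite \<Phi>"
  and span_roots: "span \<Phi> = UNIV"
  and zero_not_root: "0 \<notin> \<Phi>"
  and reduced: "\<alpha> \<in> \<Phi> \<Longrightarrow> c *\<^sub>R \<alpha> \<in> \<Phi> \<Longrightarrow> c = 1 \<or> c = -1"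
  and reflection_roots: "\<alpha> \<in> \<Phi> \<Longrightarrow> reflection \<alpha> ` \<Phi> = \<Phi>"
  and crystallographic: "\<alpha> \<in> \<Phi> \<Longrightarrow> \<beta> \<in> \<Phi> \<Longrightarrow> 2 * (\<beta> \<bullet> \<alpha>) / (\<alpha> \<bullet> \<alpha>) \<in> \<int>"
  using root_system by (simp_all add: root_system_def)

lemma reflection_root: "\<alpha> \<in> \<Phi> \<Longrightarrow> \<beta> \<in> \<Phi> \<Longrightarrow> reflection \<alpha> \<beta> \<in> \<Phi>"
  using reflection_roots by blast

lemma uminus_root: "\<alpha> \<in> \<Phi> \<Longrightarrow> - \<alpha> \<in> \<Phi>"
  using reflection_root[of \<alpha> \<alpha>] by (simp add: reflection_self)

lemma uminus_root_iff [simp]: "- \<alpha> \<in> \<Phi> \<longleftrightarrow> \<alpha> \<in> \<Phi>"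
  using uminus_root[of \<alpha>] uminus_root[of "- \<alpha>"] by auto

lemma inner_root_pos: "\<alpha> \<in> \<Phi> \<Longrightarrow> \<alpha> \<bullet> \<alpha> > 0"
  using zero_not_root by (metis inner_gt_zero_iff)

text \<open>Both Cartan integers m and n are positive. If one of them is 1, a reflection produces
  the difference up to sign; if both are at least 2, the two roots coincide.\<close>

lemma root_diff:
  assumes roots: "\<alpha> \<in> \<Phi>" "\<beta> \<in> \<Phi>" and pos: "\<beta> \<bullet> \<alpha> > 0" and "\<beta> \<noteq> \<alpha>"
  shows "\<beta> - \<alpha> \<in> \<Phi>"
proof -
  note a = inner_root_pos[OF roots(1)] and b = inner_root_pos[OF roots(2)]
  obtain m where m: "2 * (\<beta> \<bullet> \<alpha>) / (\<alpha> \<bullet> \<alpha>) = of_int m"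
    using crystallographic[OF roots] by (auto elim: Ints_cases)
  obtain n where n: "2 * (\<alpha> \<bullet> \<beta>) / (\<beta> \<bullet> \<beta>) = of_int n"
    using crystallographic[OF roots(2,1)] by (auto elim: Ints_cases)
  have "of_int m > (0::real)" unfolding m[symmetric] using pos a by simp
  moreover have "of_int n > (0::real)" unfolding n[symmetric] using pos b by (simp add: inner_commute)
  ultimately have mn: "m > 0" "n > 0" by simp_all
  consider "m = 1" | "n = 1" | "m \<ge> 2" "n \<ge> 2" using mn by linarith
  then show ?thesis
  proof cases
    case 1
    have "reflection \<alpha> \<beta> = \<beta> - \<alpha>" unfolding reflection_def m 1 by simp
    then show ?thesis using reflection_root[OF roots] by simp
  next
    case 2
    have "reflection \<beta> \<alpha> = \<alpha> - \<beta>" unfolding reflection_def n 2 by simp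
    then have "- (\<beta> - \<alpha>) \<in> \<Phi>" using reflection_root[OF roots(2,1)] by simp
    then show ?thesis by (simp only: uminus_root_iff)
  next
    case 3
    have "(\<beta> \<bullet> \<alpha>) \<ge> \<alpha> \<bullet> \<alpha>"
    proof -
      have "2 * (\<beta> \<bullet> \<alpha>) = of_int m * (\<alpha> \<bullet> \<alpha>)" using m a by (simp add: field_simps)
      moreover have "of_int m * (\<alpha> \<bullet> \<alpha>) \<ge> 2 * (\<alpha> \<bullet> \<alpha>)" using 3 a by (intro mult_right_mono) auto
      ultimately show ?thesis by simp
    qed
    moreover have "(\<beta> \<bullet> \<alpha>) \<ge> \<beta> \<bullet> \<beta>"
    proof -
      have "2 * (\<beta> \<bullet> \<alpha>) = of_int n * (\<beta> \<bullet> \<beta>)" using n b by (simp add: field_simps inner_commute)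
      moreover have "of_int n * (\<beta> \<bullet> \<beta>) \<ge> 2 * (\<beta> \<bullet> \<beta>)" using 3 b by (intro mult_right_mono) auto
      ultimately show ?thesis by simp
    qed
    \<comment> \<open>Both squared norms are at most the inner product, so expanding the square of
      the difference gives a nonpositive value.\<close>
    ultimately have "(\<beta> - \<alpha>) \<bullet> (\<beta> - \<alpha>) \<le> 0"
      by (simp add: inner_diff_left inner_diff_right inner_commute)
    then have "\<beta> = \<alpha>" by (metis eq_iff_diff_eq_0 inner_gt_zero_iff not_less)
    with \<open>\<beta> \<noteq> \<alpha>\<close> show ?thesis by simp
  qed
qed

text \<open>Descent along the \<alpha>-string: adding -\<alpha> to \<beta> stays in F and lowers n
  by 2. The induction hypothesis reflects \<beta> - \<alpha>, and adding -\<alpha> once more gives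
  the reflection of \<beta>.\<close>

lemma reflection_closed_nonneg:
  assumes F: "root_closed \<Phi> F" and "\<alpha> \<in> F" "- \<alpha> \<in> F" "\<beta> \<in> F"
    and "2 * (\<beta> \<bullet> \<alpha>) / (\<alpha> \<bullet> \<alpha>) = real n"
  shows "reflection \<alpha> \<beta> \<in> F"
  using assms(4,5)
proof (induction n arbitrary: \<beta> rule: less_induct)
  case (less n)
  have roots: "\<alpha> \<in> \<Phi>" "\<beta> \<in> \<Phi>" and "\<alpha> \<bullet> \<alpha> > 0"
    using F \<open>\<alpha> \<in> F\<close> less.prems inner_root_pos by (auto simp: root_closed_def)
  consider "n = 0" | "\<beta> = \<alpha>" | "n > 0" "\<beta> \<noteq> \<alpha>" by auto
  then show ?case
  proof cases
    case 1
    show ?thesis using less.prems(1) unfolding reflection_def less.prems(2) 1 by simp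
  next
    case 2
    then show ?thesis using assms(3) by (simp add: reflection_self)
  next
    case 3
    then have "0 < 2 * (\<beta> \<bullet> \<alpha>) / (\<alpha> \<bullet> \<alpha>)" using less.prems by simp
    then have "\<beta> \<bullet> \<alpha> > 0" using \<open>\<alpha> \<bullet> \<alpha> > 0\<close> by (simp add: zero_less_divide_iff)
    then have "\<beta> - \<alpha> \<in> \<Phi>" using root_diff[OF roots] 3 by blast
    then have diff: "\<beta> - \<alpha> \<in> F"
      using F \<open>- \<alpha> \<in> F\<close> \<open>\<beta> \<in> F\<close> unfolding root_closed_def by (metis add_uminus_conv_diff)
    have step: "2 * ((\<beta> - \<alpha>) \<bullet> \<alpha>) / (\<alpha> \<bullet> \<alpha>) = real n - 2"
      using less.prems \<open>\<alpha> \<bullet> \<alpha> > 0\<close> by (simp add: inner_diff_left field_simps)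
    \<comment> \<open>The case n = 1 is separate because n - 2 would be truncated; the reflection of
      \<beta> is then already \<beta> - \<alpha>.\<close>
    show ?thesis
    proof (cases "n = 1")
      case True
      have "reflection \<alpha> \<beta> = \<beta> - \<alpha>" unfolding reflection_def less.prems(2) True by simp
      with diff show ?thesis by simp
    next
      case False
      then have "reflection \<alpha> (\<beta> - \<alpha>) \<in> F"
        using 3 diff step by (intro less.IH[of "n - 2"]) (auto simp: of_nat_diff)
      then have "reflection \<alpha> \<beta> + \<alpha> \<in> F" by (simp add: reflection_simps reflection_self)
      moreover have "(reflection \<alpha> \<beta> + \<alpha>) + - \<alpha> \<in> \<Phi>" using reflection_root[OF roots] by simp
      ultimately have "(reflection \<alpha> \<beta> + \<alpha>) + - \<alpha> \<in> F"
        using F \<open>- \<alpha> \<in> F\<close> unfolding root_closed_def by blast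
      then show ?thesis by simp
    qed
  qed
qed

text \<open>A negative Cartan integer becomes positive on replacing \<alpha> by -\<alpha>, which has
  the same reflection. Inclusion gives equality because the reflection is an involution.\<close>

lemma reflection_closed_set:
  assumes F: "root_closed \<Phi> F" and "\<alpha> \<in> F" "- \<alpha> \<in> F"
  shows "reflection \<alpha> ` F = F"
proof -
  have *: "reflection \<alpha> \<beta> \<in> F" if "\<beta> \<in> F" for \<beta>
  proof -
    have roots: "\<alpha> \<in> \<Phi>" "\<beta> \<in> \<Phi>" using F \<open>\<alpha> \<in> F\<close> that by (auto simp: root_closed_def)
    obtain m where m: "2 * (\<beta> \<bullet> \<alpha>) / (\<alpha> \<bullet> \<alpha>) = of_int m"
      using crystallographic[OF roots] by (auto elim: Ints_cases)
    show ?thesis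
    proof (cases "m \<ge> 0")
      case True
      then have "2 * (\<beta> \<bullet> \<alpha>) / (\<alpha> \<bullet> \<alpha>) = real (nat m)" using m by simp
      then show ?thesis using reflection_closed_nonneg assms that by blast
    next
      case False
      then have "2 * (\<beta> \<bullet> (- \<alpha>)) / ((- \<alpha>) \<bullet> (- \<alpha>)) = real (nat (- m))" using m by simp
      then have "reflection (- \<alpha>) \<beta> \<in> F"
        using reflection_closed_nonneg[of F "- \<alpha>"] assms that by simp
      then show ?thesis by simp
    qed
  qed
  have "F \<subseteq> reflection \<alpha> ` F"
  proof
    fix \<beta> assume "\<beta> \<in> F"
    then show "\<beta> \<in> reflection \<alpha> ` F" using * by (intro image_eqI[of _ _ "reflection \<alpha> \<beta>"]) auto
  qed
  with * show ?thesis by blast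
qed

text \<open>If both signs of \<alpha> lie outside F, the closed complement is the set that is
  reflected into itself, and hence so is F.\<close>

lemma reflection_biclosed_set:
  assumes F: "biclosed_in \<Phi> \<Phi> F" and "\<alpha> \<in> \<Phi>" "\<alpha> \<in> F \<longleftrightarrow> - \<alpha> \<in> F"
  shows "reflection \<alpha> ` F = F"
proof (cases "\<alpha> \<in> F")
  case True
  then show ?thesis using assms reflection_closed_set by (auto simp: biclosed_in_def)
next
  case False
  then have "reflection \<alpha> ` (\<Phi> - F) = \<Phi> - F"
    using assms by (intro reflection_closed_set) (auto simp: biclosed_in_def)
  then have "\<Phi> - reflection \<alpha> ` F = \<Phi> - F"
    using image_set_diff[OF inj_reflection, of \<alpha> \<Phi> F] reflection_roots[OF assms(2)] by simp
  moreover have "reflection \<alpha> ` F \<subseteq> \<Phi>" "F \<subseteq> \<Phi>"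
    using F reflection_roots[OF assms(2)] by (auto simp: biclosed_in_def)
  ultimately show ?thesis by blast
qed

lemma weyl_image_roots: "w \<in> weyl_group \<Phi> \<Longrightarrow> w ` \<Phi> = \<Phi>"
proof (induction rule: reflection_group_induct)
  case (comp \<alpha> w)
  then show ?case by (metis image_comp reflection_roots)
qed simp

end

section \<open>Simple systems and the coordinates they define\<close>

locale based_root_system = finite_root_system \<Phi>
  for \<Phi> :: "'a::euclidean_space set" +
  fixes \<Delta> :: "'a set"
  assumes simple_system: "simple_system \<Phi> \<Delta>"
begin

abbreviation pos :: "'a set" where "pos \<equiv> positive_roots \<Phi> \<Delta>"

text \<open>The simple root is the first argument so that \<open>coef \<delta>\<close> is a linear
  functional.\<close>

definition coef :: "'a \<Rightarrow> 'a \<Rightarrow> real" where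
  "coef \<delta> v = representation \<Delta> v \<delta>"

lemma simple_root: "\<delta> \<in> \<Delta> \<Longrightarrow> \<delta> \<in> \<Phi>"
  and independent_simple: "independent \<Delta>"
  and pos_or_neg: "\<alpha> \<in> \<Phi> \<Longrightarrow> \<alpha> \<in> pos \<or> - \<alpha> \<in> pos"
  using simple_system by (auto simp: simple_system_def)

lemma pos_root: "\<alpha> \<in> pos \<Longrightarrow> \<alpha> \<in> \<Phi>"
  by (simp add: positive_roots_def)

lemma finite_simple [simp]: "finite \<Delta>"
  using finite_subset[OF _ finite_roots] simple_root by blast

lemma span_simple: "span \<Delta> = UNIV"
proof -
  have "\<alpha> \<in> span \<Delta>" if "\<alpha> \<in> pos" for \<alpha>
    using that unfolding positive_roots_def by (auto intro: span_sum span_scale span_base)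
  then have "\<Phi> \<subseteq> span \<Delta>"
    using pos_or_neg span_neg by (metis add.inverse_inverse subsetI)
  then have "span \<Phi> \<subseteq> span \<Delta>" by (simp add: span_minimal)
  then show ?thesis using span_roots by blast
qed

lemma linear_coef: "linear (coef \<delta>)"
  unfolding coef_def
  by (rule linearI) (simp_all add: real_vector.representation_add real_vector.representation_scale
      independent_simple span_simple)

lemmas coef_simps =
  linear_add[OF linear_coef] linear_diff[OF linear_coef]
  linear_neg[OF linear_coef] linear_cmul[OF linear_coef]

lemma coef_simple: "\<epsilon> \<in> \<Delta> \<Longrightarrow> coef \<delta> \<epsilon> = (if \<delta> = \<epsilon> then 1 else 0)"
  by (simp add: coef_def real_vector.representation_basis[OF independent_simple])

lemma coef_expansion: "(\<Sum>\<delta>\<in>\<Delta>. coef \<delta> v *\<^sub>R \<delta>) = v"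
  unfolding coef_def
  by (rule real_vector.sum_representation_eq) (simp_all add: independent_simple span_simple)

lemma coef_sum:
  assumes "\<delta> \<in> \<Delta>"
  shows "coef \<delta> (\<Sum>\<epsilon>\<in>\<Delta>. c \<epsilon> *\<^sub>R \<epsilon>) = c \<delta>"
proof -
  have "coef \<delta> (\<Sum>\<epsilon>\<in>\<Delta>. c \<epsilon> *\<^sub>R \<epsilon>) = (\<Sum>\<epsilon>\<in>\<Delta>. c \<epsilon> * (if \<delta> = \<epsilon> then 1 else 0))"
    by (simp add: linear_sum[OF linear_coef] coef_simps coef_simple)
  also have "\<dots> = (\<Sum>\<epsilon>\<in>\<Delta>. if \<delta> = \<epsilon> then c \<epsilon> else 0)"
    by (rule sum.cong) auto
  also have "\<dots> = c \<delta>" using assms by simp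
  finally show ?thesis .
qed

lemma coef_span_iff:
  assumes "\<Delta>' \<subseteq> \<Delta>"
  shows "v \<in> span \<Delta>' \<longleftrightarrow> (\<forall>\<delta>\<in>\<Delta> - \<Delta>'. coef \<delta> v = 0)"
proof
  assume "v \<in> span \<Delta>'"
  then show "\<forall>\<delta>\<in>\<Delta> - \<Delta>'. coef \<delta> v = 0"
  proof (induction rule: span_induct)
    case base
    then show ?case
      by (auto simp: subspace_def coef_simps linear_0[OF linear_coef])
  next
    case (step x)
    then show ?case using assms by (auto simp: coef_simple)
  qed
next
  assume 0: "\<forall>\<delta>\<in>\<Delta> - \<Delta>'. coef \<delta> v = 0"
  have "(\<Sum>\<delta>\<in>\<Delta>. coef \<delta> v *\<^sub>R \<delta>) = (\<Sum>\<delta>\<in>\<Delta>'. coef \<delta> v *\<^sub>R \<delta>)"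
    using assms 0 by (intro sum.mono_neutral_right) auto
  then have "v = (\<Sum>\<delta>\<in>\<Delta>'. coef \<delta> v *\<^sub>R \<delta>)" by (simp add: coef_expansion)
  also have "\<dots> \<in> span \<Delta>'" by (intro span_sum span_scale span_base)
  finally show "v \<in> span \<Delta>'" .
qed

lemma eq_zero_if_coef: "(\<And>\<delta>. \<delta> \<in> \<Delta> \<Longrightarrow> coef \<delta> v = 0) \<Longrightarrow> v = 0"
  using coef_span_iff[of "{}" v] by simp

lemma coef_pos_nonneg: "\<alpha> \<in> pos \<Longrightarrow> \<delta> \<in> \<Delta> \<Longrightarrow> 0 \<le> coef \<delta> \<alpha>"
  by (auto simp: positive_roots_def coef_sum)

text \<open>The root -\<alpha> has a negative coordinate and so cannot be positive. One positive
  coordinate thus decides the sign of a root, which is the positivity test used throughout.\<close>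

lemma posI:
  assumes "\<alpha> \<in> \<Phi>" "\<delta> \<in> \<Delta>" "coef \<delta> \<alpha> > 0"
  shows "\<alpha> \<in> pos"
  using pos_or_neg[OF assms(1)] coef_pos_nonneg[of "- \<alpha>" \<delta>] assms by (auto simp: coef_simps)

lemma pos_obtain_coef:
  assumes "\<alpha> \<in> pos"
  obtains \<delta> where "\<delta> \<in> \<Delta>" "coef \<delta> \<alpha> > 0"
proof -
  have "\<alpha> \<noteq> 0" using assms pos_root zero_not_root by blast
  then obtain \<delta> where "\<delta> \<in> \<Delta>" "coef \<delta> \<alpha> \<noteq> 0" using eq_zero_if_coef by blast
  then show ?thesis using coef_pos_nonneg[OF assms] that by (metis less_eq_real_def)
qed

lemma uminus_pos_iff:
  assumes "\<alpha> \<in> \<Phi>"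
  shows "- \<alpha> \<in> pos \<longleftrightarrow> \<alpha> \<notin> pos"
proof -
  have False if \<alpha>: "\<alpha> \<in> pos" "- \<alpha> \<in> pos"
  proof -
    obtain \<delta> where "\<delta> \<in> \<Delta>" "coef \<delta> \<alpha> > 0" using pos_obtain_coef[OF \<alpha>(1)] .
    then show False using coef_pos_nonneg[OF \<alpha>(2), of \<delta>] by (simp add: coef_simps)
  qed
  then show ?thesis using pos_or_neg[OF assms] by blast
qed

lemma simple_pos: "\<delta> \<in> \<Delta> \<Longrightarrow> \<delta> \<in> pos"
  by (rule posI[of \<delta> \<delta>]) (simp_all add: simple_root coef_simple)

text \<open>Otherwise \<beta> is a multiple of \<alpha>; reducedness leaves only the factors 1 and
  -1, and the second contradicts nonnegative coordinates.\<close>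

lemma pos_coef_other:
  assumes "\<beta> \<in> pos" "\<alpha> \<in> \<Delta>" "\<beta> \<noteq> \<alpha>"
  obtains \<delta> where "\<delta> \<in> \<Delta>" "\<delta> \<noteq> \<alpha>" "coef \<delta> \<beta> > 0"
proof (rule ccontr)
  assume "\<not> thesis"
  with that have "coef \<delta> \<beta> = 0" if "\<delta> \<in> \<Delta>" "\<delta> \<noteq> \<alpha>" for \<delta>
    using that coef_pos_nonneg[OF assms(1)] by fastforce
  then have "\<beta> - coef \<alpha> \<beta> *\<^sub>R \<alpha> = 0"
    using assms(2) by (intro eq_zero_if_coef) (auto simp: coef_simps coef_simple)
  then have \<beta>: "\<beta> = coef \<alpha> \<beta> *\<^sub>R \<alpha>" by simp
  then have "coef \<alpha> \<beta> = 1 \<or> coef \<alpha> \<beta> = -1"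
    using reduced[of \<alpha> "coef \<alpha> \<beta>"] assms pos_root simple_root by metis
  with coef_pos_nonneg[OF assms(1,2)] have "coef \<alpha> \<beta> = 1" by simp
  with \<beta> assms(3) show False by simp
qed

lemma coef_reflection: "coef \<delta> (reflection \<alpha> \<beta>) = coef \<delta> \<beta> - (2 * (\<beta> \<bullet> \<alpha>) / (\<alpha> \<bullet> \<alpha>)) * coef \<delta> \<alpha>"
  by (simp add: reflection_def coef_simps)

text \<open>The reflection in \<alpha> alters only the coordinate at \<alpha>, so a positive
  coordinate elsewhere survives.\<close>

lemma simple_reflection_pos:
  assumes "\<beta> \<in> pos" "\<alpha> \<in> \<Delta>" "\<beta> \<noteq> \<alpha>"
  shows "reflection \<alpha> \<beta> \<in> pos"
proof -
  obtain \<delta> where "\<delta> \<in> \<Delta>" "\<delta> \<noteq> \<alpha>" "coef \<delta> \<beta> > 0" using pos_coef_other[OF assms] .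
  then show ?thesis
    using assms pos_root simple_root
    by (intro posI[of _ \<delta>] reflection_root) (auto simp: coef_reflection coef_simple)
qed

text \<open>Otherwise expanding one factor of \<beta> \<bullet> \<beta> in simple roots would give
  only nonpositive terms.\<close>

lemma pos_obtain_simple:
  assumes "\<beta> \<in> pos"
  obtains \<alpha> where "\<alpha> \<in> \<Delta>" "coef \<alpha> \<beta> > 0" "\<beta> \<bullet> \<alpha> > 0"
proof (rule ccontr)
  assume no: "\<not> thesis"
  have "\<beta> \<bullet> \<beta> = \<beta> \<bullet> (\<Sum>\<delta>\<in>\<Delta>. coef \<delta> \<beta> *\<^sub>R \<delta>)" by (simp add: coef_expansion)
  also have "\<dots> = (\<Sum>\<delta>\<in>\<Delta>. coef \<delta> \<beta> * (\<beta> \<bullet> \<delta>))" by (simp add: inner_sum_right)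
  also have "\<dots> \<le> 0"
  proof (rule sum_nonpos)
    fix \<delta> assume "\<delta> \<in> \<Delta>"
    then show "coef \<delta> \<beta> * (\<beta> \<bullet> \<delta>) \<le> 0"
      using no that coef_pos_nonneg[OF assms] by (force simp: mult_le_0_iff)
  qed
  finally show False using inner_root_pos[OF pos_root[OF assms]] by simp
qed

section \<open>Height and induction over positive roots\<close>

definition height :: "'a \<Rightarrow> real" where
  "height v = (\<Sum>\<delta>\<in>\<Delta>. coef \<delta> v)"

lemma height_diff_simple: "\<alpha> \<in> \<Delta> \<Longrightarrow> height (v - c *\<^sub>R \<alpha>) = height v - c"
  by (simp add: height_def coef_simps coef_simple sum_subtractf sum_distrib_left[symmetric])

text \<open>Height is real-valued here; the induction is well-founded because only finitely many
  roots have smaller height, and their number is the measure.\<close>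

lemma pos_height_induct [consumes 1, case_names less]:
  assumes "\<beta> \<in> pos"
    and step: "\<And>\<beta>. \<beta> \<in> pos \<Longrightarrow> (\<And>\<gamma>. \<gamma> \<in> pos \<Longrightarrow> height \<gamma> < height \<beta> \<Longrightarrow> P \<gamma>) \<Longrightarrow> P \<beta>"
  shows "P \<beta>"
  using assms(1)
proof (induction "card {\<gamma> \<in> \<Phi>. height \<gamma> < height \<beta>}" arbitrary: \<beta> rule: less_induct)
  case less
  show ?case
  proof (rule step)
    fix \<gamma> assume \<gamma>: "\<gamma> \<in> pos" "height \<gamma> < height \<beta>"
    then have "{\<epsilon> \<in> \<Phi>. height \<epsilon> < height \<gamma>} \<subset> {\<epsilon> \<in> \<Phi>. height \<epsilon> < height \<beta>}"
      using pos_root[OF \<gamma>(1)] by auto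
    then show "P \<gamma>" using \<gamma> by (intro less.hyps psubset_card_mono) auto
  qed fact
qed

text \<open>A nonsimple positive root is the sum of a positive root of smaller height and a simple
  root.\<close>

lemma pos_subset_closed:
  assumes G: "root_closed \<Phi> G" and "\<Delta> \<subseteq> G"
  shows "pos \<subseteq> G"
proof
  fix \<beta> assume "\<beta> \<in> pos"
  then show "\<beta> \<in> G"
  proof (induction rule: pos_height_induct)
    case (less \<beta>)
    show ?case
    proof (cases "\<beta> \<in> \<Delta>")
      case False
      obtain \<alpha> where \<alpha>: "\<alpha> \<in> \<Delta>" "\<beta> \<bullet> \<alpha> > 0" using pos_obtain_simple[OF less.hyps] by metis
      then have ne: "\<beta> \<noteq> \<alpha>" using False by blast
      have diff: "\<beta> - \<alpha> \<in> \<Phi>"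
        using root_diff \<alpha> ne less.hyps pos_root simple_root by blast
      \<comment> \<open>This coordinate is untouched by subtracting \<alpha>, so it certifies that
        the difference is positive.\<close>
      obtain \<delta> where "\<delta> \<in> \<Delta>" "\<delta> \<noteq> \<alpha>" "coef \<delta> \<beta> > 0"
        using pos_coef_other[OF less.hyps \<alpha>(1) ne] .
      then have "\<beta> - \<alpha> \<in> pos"
        using diff \<alpha> by (intro posI[of _ \<delta>]) (auto simp: coef_simps coef_simple)
      then have "\<beta> - \<alpha> \<in> G" using less.IH height_diff_simple[OF \<alpha>(1), of \<beta> 1] by simp
      moreover have "(\<beta> - \<alpha>) + \<alpha> \<in> \<Phi>" using less.hyps pos_root by simp
      ultimately have "(\<beta> - \<alpha>) + \<alpha> \<in> G"
        using G \<alpha>(1) assms(2) unfolding root_closed_def by blast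
      then show ?thesis by simp
    qed (use assms(2) in blast)
  qed
qed

text \<open>A simple reflection lowers the height of \<beta> without leaving the span; conjugating
  back recovers the reflection in \<beta>.\<close>

lemma reflection_in_parabolic:
  assumes "\<Delta>' \<subseteq> \<Delta>" "\<beta> \<in> \<Phi>" "\<beta> \<in> span \<Delta>'"
  shows "reflection \<beta> \<in> parabolic_subgroup \<Delta>'"
proof -
  have *: "reflection \<beta> \<in> parabolic_subgroup \<Delta>'" if "\<beta> \<in> pos" "\<beta> \<in> span \<Delta>'" for \<beta>
    using that
  proof (induction rule: pos_height_induct)
    case (less \<beta>)
    obtain \<alpha> where \<alpha>: "\<alpha> \<in> \<Delta>" "coef \<alpha> \<beta> > 0" "\<beta> \<bullet> \<alpha> > 0"
      using pos_obtain_simple[OF less.hyps] .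
    \<comment> \<open>Vectors in the span have zero coordinates outside \<open>\<Delta>'\<close>,
      whereas \<beta> has a positive one at \<alpha>.\<close>
    have "\<alpha> \<in> \<Delta>'" using \<alpha> less.prems coef_span_iff[OF assms(1)] by force
    then have s\<alpha>: "reflection \<alpha> \<in> parabolic_subgroup \<Delta>'" by (rule reflection_in_group)
    show ?case
    proof (cases "\<beta> = \<alpha>")
      case False
      have "reflection \<alpha> \<beta> \<in> pos" using simple_reflection_pos less.hyps \<alpha> False by blast
      moreover have "height (reflection \<alpha> \<beta>) < height \<beta>"
        using \<alpha> inner_root_pos[OF simple_root[OF \<alpha>(1)]]
        by (simp add: reflection_def height_diff_simple)
      moreover have "reflection \<alpha> \<beta> \<in> span \<Delta>'"
        unfolding reflection_def using less.prems \<open>\<alpha> \<in> \<Delta>'\<close>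
        by (intro span_diff span_scale) (auto intro: span_base)
      ultimately have "reflection (reflection \<alpha> \<beta>) \<in> parabolic_subgroup \<Delta>'" by (rule less.IH)
      then have "reflection \<alpha> \<circ> reflection (reflection \<alpha> \<beta>) \<circ> reflection \<alpha> \<in> parabolic_subgroup \<Delta>'"
        using s\<alpha> by (intro reflection_group_comp)
      also have "reflection \<alpha> \<circ> reflection (reflection \<alpha> \<beta>) \<circ> reflection \<alpha> = reflection \<beta>"
        by (simp add: reflection_conj fun_eq_iff)
      finally show ?thesis .
    qed (use s\<alpha> in simp)
  qed
  show ?thesis
    using pos_or_neg[OF assms(2)] *[of \<beta>] *[of "- \<beta>"] assms(3) by (auto simp: span_neg)
qed

section \<open>Simple generators of the Weyl group and the exchange condition\<close>

lemma weyl_group_eq_simple: "weyl_group \<Phi> = reflection_group \<Delta>"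
proof
  show "weyl_group \<Phi> \<subseteq> reflection_group \<Delta>"
    using reflection_in_parabolic[of \<Delta>] span_simple by (intro reflection_group_subset) auto
  show "reflection_group \<Delta> \<subseteq> weyl_group \<Phi>"
    using simple_root reflection_in_group by (intro reflection_group_subset) blast
qed

text \<open>As the letters are applied to \<alpha> from the right, one of them first makes the image
  negative. That letter is the reflection in the image itself, and by conjugation it cancels against
  the reflection in \<alpha>.\<close>

lemma exchange:
  assumes "as \<in> lists \<Delta>" "\<alpha> \<in> \<Delta>" "reflection_word as \<alpha> \<notin> pos"
  shows "\<exists>bs\<in>lists \<Delta>. length bs < length as \<and> reflection_word as \<circ> reflection \<alpha> = reflection_word bs"
  using assms(1,3)
proof induction
  case Nil
  then show ?case using simple_pos[OF assms(2)] by simp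
next
  case (Cons \<gamma> as)
  show ?case
  proof (cases "reflection_word as \<alpha> \<in> pos")
    case True
    \<comment> \<open>The only positive root that a simple reflection makes negative is its own
      simple root.\<close>
    with Cons.prems Cons.hyps have \<gamma>: "\<gamma> = reflection_word as \<alpha>"
      using simple_reflection_pos by fastforce
    have "reflection_word (\<gamma> # as) \<circ> reflection \<alpha> = reflection_word as"
      by (simp add: \<gamma> reflection_word_conj fun_eq_iff)
    then show ?thesis using Cons.hyps(2) by (metis length_Cons lessI)
  next
    case False
    then obtain bs where bs: "bs \<in> lists \<Delta>" "length bs < length as"
      "reflection_word as \<circ> reflection \<alpha> = reflection_word bs"
      using Cons.IH by blast
    have "reflection_word (\<gamma> # as) \<circ> reflection \<alpha> = reflection_word (\<gamma> # bs)"
      by (simp only: reflection_word_Cons comp_assoc bs(3))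
    moreover have "\<gamma> # bs \<in> lists \<Delta>" "length (\<gamma> # bs) < length (\<gamma> # as)"
      using bs Cons.hyps by simp_all
    ultimately show ?thesis by blast
  qed
qed

text \<open>A shortest word for w must be empty: since w keeps its last letter \<alpha> positive,
  the remaining word makes \<alpha> negative, and exchange would yield a shorter word for w.\<close>

lemma weyl_fixes_pos:
  assumes "w \<in> weyl_group \<Phi>" "w ` pos \<subseteq> pos"
  shows "w = id"
proof -
  define Q where "Q as \<longleftrightarrow> as \<in> lists \<Delta> \<and> reflection_word as = w" for as
  have "\<exists>as. Q as"
    using assms(1)[unfolded weyl_group_eq_simple] unfolding reflection_group_eq Q_def by blast
  then obtain as where "Q as" and min: "\<And>bs. length bs < length as \<Longrightarrow> \<not> Q bs"
    using exists_least_iff[of "\<lambda>n. \<exists>as. length as = n \<and> Q as"] by metis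
  show ?thesis
  proof (cases as rule: rev_cases)
    case Nil
    then show ?thesis using \<open>Q as\<close> by (simp add: Q_def)
  next
    case (snoc as' \<alpha>)
    then have as': "as' \<in> lists \<Delta>" "\<alpha> \<in> \<Delta>" "w = reflection_word as' \<circ> reflection \<alpha>"
      using \<open>Q as\<close> by (auto simp: Q_def)
    have lin: "linear (reflection_word as')"
      using as'(1) reflection_group_linear by (auto simp: reflection_group_eq)
    have "w \<alpha> \<in> pos" using assms(2) simple_pos as'(2) by blast
    then have "- reflection_word as' \<alpha> \<in> pos"
      using as'(3) by (simp add: reflection_self linear_neg[OF lin])
    then have "reflection_word as' \<alpha> \<notin> pos"
      using uminus_pos_iff[of "reflection_word as' \<alpha>"] pos_root by fastforce
    then obtain bs where "bs \<in> lists \<Delta>" "length bs < length as'" "w = reflection_word bs"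
      using exchange[OF as'(1,2)] as'(3) by blast
    then show ?thesis using min[of bs] snoc by (simp add: Q_def)
  qed
qed

section \<open>Reflecting a simple system\<close>

lemma reflect_pos:
  assumes "\<alpha> \<in> \<Phi>"
  shows "positive_roots \<Phi> (reflection \<alpha> ` \<Delta>) = reflection \<alpha> ` pos"
proof -
  let ?s = "reflection \<alpha>"
  have sum: "(\<Sum>\<delta>\<in>?s ` \<Delta>. real (c \<delta>) *\<^sub>R \<delta>) = ?s (\<Sum>\<delta>\<in>\<Delta>. real (c (?s \<delta>)) *\<^sub>R \<delta>)" for c
    by (simp add: sum.reindex inj_on_subset[OF inj_reflection]
        linear_sum[OF linear_reflection] reflection_simps)
  show ?thesis
  proof (intro equalityI subsetI)
    fix \<beta> assume "\<beta> \<in> positive_roots \<Phi> (?s ` \<Delta>)"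
    then obtain c where "\<beta> \<in> \<Phi>" "\<beta> = ?s (\<Sum>\<delta>\<in>\<Delta>. real (c (?s \<delta>)) *\<^sub>R \<delta>)"
      by (auto simp: positive_roots_def sum)
    then have "?s \<beta> \<in> \<Phi>" "?s \<beta> = (\<Sum>\<delta>\<in>\<Delta>. real (c (?s \<delta>)) *\<^sub>R \<delta>)"
      using reflection_root[OF assms, of \<beta>] by simp_all
    then have "?s \<beta> \<in> pos"
      unfolding positive_roots_def
      by (intro CollectI conjI exI[of _ "\<lambda>\<delta>. c (?s \<delta>)"])
    then show "\<beta> \<in> ?s ` pos" by (metis image_eqI reflection_reflection)
  next
    fix \<beta> assume "\<beta> \<in> ?s ` pos"
    then obtain c where "\<beta> \<in> \<Phi>" "\<beta> = ?s (\<Sum>\<delta>\<in>\<Delta>. real (c \<delta>) *\<^sub>R \<delta>)"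
      using reflection_root[OF assms] by (auto simp: positive_roots_def)
    then show "\<beta> \<in> positive_roots \<Phi> (?s ` \<Delta>)"
      unfolding positive_roots_def sum
      by (auto intro!: exI[of _ "\<lambda>\<delta>. c (?s \<delta>)"])
  qed
qed

lemma reflect_simple_system:
  assumes "\<alpha> \<in> \<Phi>"
  shows "simple_system \<Phi> (reflection \<alpha> ` \<Delta>)"
  unfolding simple_system_def reflect_pos[OF assms]
proof (intro conjI ballI)
  show "reflection \<alpha> ` \<Delta> \<subseteq> \<Phi>" using reflection_root assms simple_root by blast
  show "independent (reflection \<alpha> ` \<Delta>)"
    using independent_simple linear_independent_injective_image[OF linear_reflection]
      inj_on_subset[OF inj_reflection] by blast
  fix \<beta> assume "\<beta> \<in> \<Phi>"
  then have "reflection \<alpha> \<beta> \<in> pos \<or> reflection \<alpha> (- \<beta>) \<in> pos"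
    using pos_or_neg[of "reflection \<alpha> \<beta>"] reflection_root assms by (simp add: reflection_simps)
  then show "\<beta> \<in> reflection \<alpha> ` pos \<or> - \<beta> \<in> reflection \<alpha> ` pos"
    by (metis image_eqI reflection_reflection)
qed

text \<open>The reflection permutes the positive roots other than \<alpha>: none of them is sent to
  \<alpha>, because the preimage of \<alpha> is the negative root -\<alpha>.\<close>

lemma simple_reflection_image_pos:
  assumes "\<alpha> \<in> \<Delta>"
  shows "reflection \<alpha> ` pos = insert (- \<alpha>) (pos - {\<alpha>})"
proof -
  have 1: "reflection \<alpha> ` (pos - {\<alpha>}) \<subseteq> pos - {\<alpha>}"
  proof (rule image_subsetI)
    fix \<beta> assume "\<beta> \<in> pos - {\<alpha>}"
    then have \<beta>: "\<beta> \<in> pos" "\<beta> \<noteq> \<alpha>" by auto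
    have "- \<alpha> \<notin> pos" using uminus_pos_iff simple_root simple_pos assms by blast
    then have "reflection \<alpha> \<beta> \<noteq> \<alpha>"
      using \<beta> by (metis reflection_reflection reflection_self)
    then show "reflection \<alpha> \<beta> \<in> pos - {\<alpha>}" using simple_reflection_pos assms \<beta> by blast
  qed
  then have "reflection \<alpha> ` (pos - {\<alpha>}) = pos - {\<alpha>}"
    using image_mono[OF 1, of "reflection \<alpha>"] by simp
  moreover have "pos = insert \<alpha> (pos - {\<alpha>})" using simple_pos assms by blast
  ultimately show ?thesis by (metis image_insert reflection_self)
qed

lemma closed_pos: "root_closed \<Phi> pos"
  unfolding root_closed_def
proof (intro conjI ballI impI)
  show "pos \<subseteq> \<Phi>" using pos_root by blast
  fix \<alpha> \<beta> assume *: "\<alpha> \<in> pos" "\<beta> \<in> pos" "\<alpha> + \<beta> \<in> \<Phi>"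
  obtain \<delta> where \<delta>: "\<delta> \<in> \<Delta>" "coef \<delta> \<alpha> > 0" using pos_obtain_coef[OF *(1)] .
  then have "coef \<delta> (\<alpha> + \<beta>) > 0" using coef_pos_nonneg[OF *(2) \<delta>(1)] by (simp add: coef_simps)
  then show "\<alpha> + \<beta> \<in> pos" using posI *(3) \<delta>(1) by blast
qed

end

section \<open>Stabilizers of biclosed sets\<close>

context finite_root_system
begin

lemma uminus_mem_image_iff: "(\<alpha> :: 'a) \<in> uminus ` S \<longleftrightarrow> - \<alpha> \<in> S"
proof
  assume "- \<alpha> \<in> S"
  then have "- (- \<alpha>) \<in> uminus ` S" by (rule imageI)
  then show "\<alpha> \<in> uminus ` S" by simp
qed auto

text \<open>A root lies in this set iff it is in F or its negative is not. Closedness is what lets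
  the set absorb a whole positive system once it contains the simple roots.\<close>

lemma closed_Un_uminus_Diff:
  assumes F: "biclosed_in \<Phi> \<Phi> F"
  shows "root_closed \<Phi> (F \<union> uminus ` (\<Phi> - F))"
  unfolding root_closed_def
proof (intro conjI ballI impI)
  let ?G = "F \<union> uminus ` (\<Phi> - F)"
  have F': "F \<subseteq> \<Phi>"
    "\<And>\<alpha> \<beta>. \<alpha> \<in> F \<Longrightarrow> \<beta> \<in> F \<Longrightarrow> \<alpha> + \<beta> \<in> \<Phi> \<Longrightarrow> \<alpha> + \<beta> \<in> F"
    "\<And>\<alpha> \<beta>. \<alpha> \<in> \<Phi> - F \<Longrightarrow> \<beta> \<in> \<Phi> - F \<Longrightarrow> \<alpha> + \<beta> \<in> \<Phi> \<Longrightarrow> \<alpha> + \<beta> \<in> \<Phi> - F"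
    using F unfolding biclosed_in_def root_closed_def by blast+
  have G: "\<alpha> \<in> ?G \<longleftrightarrow> \<alpha> \<in> F \<or> \<alpha> \<in> \<Phi> \<and> - \<alpha> \<notin> F" for \<alpha>
    using F'(1) uminus_mem_image_iff[of \<alpha> "\<Phi> - F"] by auto
  show "?G \<subseteq> \<Phi>" using F'(1) by auto
  \<comment> \<open>If the sum were outside, its negative would be in F, and adding \<alpha> to that
    would put -\<beta> into F.\<close>
  have mixed: "\<alpha> + \<beta> \<in> ?G" if "\<alpha> \<in> F" "\<beta> \<in> \<Phi>" "- \<beta> \<notin> F" "\<alpha> + \<beta> \<in> \<Phi>" for \<alpha> \<beta>
  proof (rule ccontr)
    assume "\<alpha> + \<beta> \<notin> ?G"
    then have "- (\<alpha> + \<beta>) \<in> F" using that(4) unfolding G by blast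
    moreover have "\<alpha> + - (\<alpha> + \<beta>) = - \<beta>" by simp
    ultimately show False using F'(2)[of \<alpha> "- (\<alpha> + \<beta>)"] that by simp
  qed
  fix \<alpha> \<beta> assume *: "\<alpha> \<in> ?G" "\<beta> \<in> ?G" and sum: "\<alpha> + \<beta> \<in> \<Phi>"
  consider "\<alpha> \<in> F" "\<beta> \<in> F" | "\<alpha> \<in> F" "\<beta> \<in> \<Phi>" "- \<beta> \<notin> F" | "\<beta> \<in> F" "\<alpha> \<in> \<Phi>" "- \<alpha> \<notin> F"
    | "\<alpha> \<in> \<Phi>" "- \<alpha> \<notin> F" "\<beta> \<in> \<Phi>" "- \<beta> \<notin> F"
    using * unfolding G by blast
  then show "\<alpha> + \<beta> \<in> ?G"
  proof cases
    case 1
    then show ?thesis using F'(2) sum by blast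
  next
    case 2
    then show ?thesis using mixed sum by blast
  next
    case 3
    then show ?thesis using mixed[of \<beta> \<alpha>] sum by (simp add: add.commute)
  next
    case 4
    have "- (\<alpha> + \<beta>) \<in> \<Phi>" using sum by (simp only: uminus_root_iff)
    then have "- \<alpha> + - \<beta> \<in> \<Phi>" by simp
    then have "- \<alpha> + - \<beta> \<in> \<Phi> - F" using F'(3)[of "- \<alpha>" "- \<beta>"] 4 by simp
    then have "- (\<alpha> + \<beta>) \<notin> F" by simp
    then show ?thesis using sum unfolding G by blast
  qed
qed

text \<open>If a simple root \<open>\<alpha>\<close> violates the conclusion, reflecting in it increases the number of
  positive roots in \<open>F\<close>, so a simple system maximizing this number works.\<close>

lemma obtain_adapted_simple_system:
  assumes "simple_system \<Phi> \<Delta>" "biclosed_in \<Phi> \<Phi> F"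
  obtains \<Delta>' where "simple_system \<Phi> \<Delta>'" "\<Delta>' \<subseteq> F \<union> uminus ` (\<Phi> - F)"
proof -
  let ?f = "\<lambda>D. card (positive_roots \<Phi> D \<inter> F)"
  have bound: "\<forall>D. simple_system \<Phi> D \<longrightarrow> ?f D < Suc (card \<Phi>)"
    by (auto intro!: card_mono simp: positive_roots_def less_Suc_eq_le)
  obtain \<Delta>' where "simple_system \<Phi> \<Delta>' \<and> (\<forall>D. simple_system \<Phi> D \<longrightarrow> ?f D \<le> ?f \<Delta>')"
    using ex_has_greatest_nat[OF assms(1) bound] by (elim exE)
  then have \<Delta>': "simple_system \<Phi> \<Delta>'"
    and max: "\<And>D. simple_system \<Phi> D \<Longrightarrow> ?f D \<le> ?f \<Delta>'"
    by simp_all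
  interpret based_root_system \<Phi> \<Delta>' by unfold_locales (rule \<Delta>')
  have "\<Delta>' \<subseteq> F \<union> uminus ` (\<Phi> - F)"
  proof
    fix \<alpha> assume \<alpha>: "\<alpha> \<in> \<Delta>'"
    show "\<alpha> \<in> F \<union> uminus ` (\<Phi> - F)"
    proof (rule ccontr)
      assume no: "\<alpha> \<notin> F \<union> uminus ` (\<Phi> - F)"
      have "- \<alpha> \<in> F"
      proof (rule ccontr)
        assume "- \<alpha> \<notin> F"
        then have "- (- \<alpha>) \<in> uminus ` (\<Phi> - F)" using simple_root[OF \<alpha>] by (intro imageI) simp
        then show False using no by simp
      qed
      have "positive_roots \<Phi> (reflection \<alpha> ` \<Delta>') \<inter> F = insert (- \<alpha>) (pos \<inter> F)"
        using no \<open>- \<alpha> \<in> F\<close>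
        by (auto simp: reflect_pos[OF simple_root[OF \<alpha>]] simple_reflection_image_pos[OF \<alpha>])
      moreover have "- \<alpha> \<notin> pos" using uminus_pos_iff simple_root simple_pos \<alpha> by blast
      moreover have "finite (pos \<inter> F)" by (simp add: positive_roots_def)
      ultimately have "?f (reflection \<alpha> ` \<Delta>') = Suc (?f \<Delta>')" by simp
      then show False using max[OF reflect_simple_system[OF simple_root[OF \<alpha>]]] by simp
    qed
  qed
  with \<Delta>' show ?thesis by (rule that)
qed

end

lemma (in based_root_system) adapted_stabilizer:
  assumes F: "biclosed_in \<Phi> \<Phi> F" and \<Delta>: "\<Delta> \<subseteq> F \<union> uminus ` (\<Phi> - F)"
    and "w \<in> weyl_group \<Phi>" "w ` F = F"
  shows "w \<in> reflection_group {\<alpha> \<in> \<Phi>. \<alpha> \<in> F \<longleftrightarrow> - \<alpha> \<in> F}"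
  using assms(3,4)
proof (induction "card (w ` pos - pos)" arbitrary: w rule: less_induct)
  case less
  let ?G = "F \<union> uminus ` (\<Phi> - F)" and ?\<Psi> = "{\<alpha> \<in> \<Phi>. \<alpha> \<in> F \<longleftrightarrow> - \<alpha> \<in> F}"
  note w = less.prems
  have lin: "linear w" and w\<Phi>: "w ` \<Phi> = \<Phi>" and inj: "inj w"
    using w(1) reflection_group_linear weyl_image_roots reflection_group_bij bij_is_inj by blast+
  have fin: "finite pos" by (simp add: positive_roots_def)
  show ?case
  proof (cases "w ` pos \<subseteq> pos")
    case True
    then have "w = id" using weyl_fixes_pos w by blast
    then show ?thesis using id_in_reflection_group by blast
  next
    case False
    \<comment> \<open>The image of \<open>pos\<close> is closed, so containing the simple roots it
      would contain \<open>pos\<close>; equal cardinalities would make the two sets equal.\<close>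
    have "\<not> \<Delta> \<subseteq> w ` pos"
    proof
      assume "\<Delta> \<subseteq> w ` pos"
      moreover have "root_closed \<Phi> (w ` pos)"
        unfolding root_closed_def
      proof (intro conjI ballI impI)
        show "w ` pos \<subseteq> \<Phi>" using w\<Phi> pos_root by blast
        fix x y assume "x \<in> w ` pos" "y \<in> w ` pos" and xy: "x + y \<in> \<Phi>"
        then obtain a b where ab: "a \<in> pos" "b \<in> pos" "x = w a" "y = w b" by blast
        then have "w (a + b) \<in> w ` \<Phi>" using xy w\<Phi> by (simp add: linear_add[OF lin])
        then have "a + b \<in> \<Phi>" using inj by (simp add: inj_image_mem_iff)
        then have "a + b \<in> pos" using closed_pos ab unfolding root_closed_def by blast
        then have "w (a + b) \<in> w ` pos" by blast
        then show "x + y \<in> w ` pos" using ab by (simp add: linear_add[OF lin])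
      qed
      ultimately have "pos \<subseteq> w ` pos" using pos_subset_closed by blast
      moreover have "card (w ` pos) = card pos"
        using inj by (meson card_image inj_on_subset subset_UNIV)
      ultimately have "pos = w ` pos" using fin by (intro card_subset_eq) auto
      with False show False by blast
    qed
    then obtain \<alpha> where \<alpha>: "\<alpha> \<in> \<Delta>" "\<alpha> \<notin> w ` pos" by blast
    have \<alpha>\<Phi>: "\<alpha> \<in> \<Phi>" using simple_root \<alpha> by blast
    have neg: "- \<alpha> \<in> w ` pos"
    proof -
      obtain a where a: "a \<in> \<Phi>" "\<alpha> = w a" using \<alpha>\<Phi> w\<Phi> by blast
      then have "- a \<in> pos" using \<alpha>(2) pos_or_neg by blast
      then have "w (- a) \<in> w ` pos" by blast
      then show ?thesis using a by (simp add: linear_neg[OF lin])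
    qed
    have "w ` ?G \<subseteq> ?G"
    proof -
      have "w ` uminus ` (\<Phi> - F) = uminus ` w ` (\<Phi> - F)"
        by (auto simp: image_iff linear_neg[OF lin])
      also have "w ` (\<Phi> - F) = \<Phi> - F"
        using image_set_diff[OF inj, of \<Phi> F] w(2) w\<Phi> by simp
      finally show ?thesis using w(2) by (auto simp: image_Un)
    qed
    moreover have "pos \<subseteq> ?G" using pos_subset_closed closed_Un_uminus_Diff[OF F] \<Delta> by blast
    ultimately have "- \<alpha> \<in> ?G" using neg by blast
    moreover have "\<alpha> \<in> ?G" using \<Delta> \<alpha> by blast
    ultimately have \<Psi>: "\<alpha> \<in> ?\<Psi>" using \<alpha>\<Phi> by auto
    let ?s = "reflection \<alpha>"
    have sF: "?s ` F = F" using reflection_biclosed_set[OF F \<alpha>\<Phi>] \<Psi> by blast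
    have "?s \<circ> w \<in> reflection_group ?\<Psi>"
    proof (rule less.hyps)
      show "?s \<circ> w \<in> weyl_group \<Phi>"
        using w(1) \<alpha>\<Phi> by (intro reflection_group_comp reflection_in_group)
      show "(?s \<circ> w) ` F = F" by (simp only: image_comp[symmetric] w(2) sF)
      have "(?s \<circ> w) ` pos - pos = ?s ` (w ` pos - ?s ` pos)"
        by (simp only: image_set_diff[OF inj_reflection] image_comp[symmetric]
            reflection_image_image)
      \<comment> \<open>Reflecting replaces \<alpha> by -\<alpha> in \<open>pos\<close>, and
        \<alpha> is absent from the image under w; so exactly -\<alpha> drops out of the
        count.\<close>
      also have "w ` pos - ?s ` pos = (w ` pos - pos) - {- \<alpha>}"
        using \<alpha>(2) by (auto simp: simple_reflection_image_pos[OF \<alpha>(1)])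
      finally have eq: "(?s \<circ> w) ` pos - pos = ?s ` ((w ` pos - pos) - {- \<alpha>})" .
      have "- \<alpha> \<notin> pos" using uminus_pos_iff \<alpha>\<Phi> simple_pos \<alpha>(1) by blast
      then have "(w ` pos - pos) - {- \<alpha>} \<subset> w ` pos - pos" using neg by blast
      then have "card ((w ` pos - pos) - {- \<alpha>}) < card (w ` pos - pos)"
        using fin by (intro psubset_card_mono) auto
      moreover have "card (?s ` ((w ` pos - pos) - {- \<alpha>})) \<le> card ((w ` pos - pos) - {- \<alpha>})"
        using fin by (intro card_image_le) auto
      ultimately show "card ((?s \<circ> w) ` pos - pos) < card (w ` pos - pos)" unfolding eq by linarith
    qed
    then have mem: "?s \<circ> (?s \<circ> w) \<in> reflection_group ?\<Psi>"
      by (rule reflection_group_comp[OF reflection_in_group[OF \<Psi>]])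
    have "?s \<circ> (?s \<circ> w) = w" by (simp add: fun_eq_iff)
    then show ?thesis using mem by metis
  qed
qed

text \<open>The given simple system starts the search for one adapted to F, to which the preceding
  result applies.\<close>

lemma (in finite_root_system) set_stabilizer_subset:
  assumes "simple_system \<Phi> \<Delta>" and F: "biclosed_in \<Phi> \<Phi> F"
  shows "set_stabilizer \<Phi> F \<subseteq> reflection_group {\<alpha> \<in> \<Phi>. \<alpha> \<in> F \<longleftrightarrow> - \<alpha> \<in> F}"
proof -
  obtain \<Delta>' where \<Delta>': "simple_system \<Phi> \<Delta>'" "\<Delta>' \<subseteq> F \<union> uminus ` (\<Phi> - F)"
    using obtain_adapted_simple_system[OF assms] .
  interpret based_root_system \<Phi> \<Delta>' by unfold_locales (rule \<Delta>')
  show ?thesis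
    using adapted_stabilizer[OF F \<Delta>'(2)] by (auto simp: set_stabilizer_def)
qed

section \<open>Biclosed sets in a standard parabolic subset\<close>

locale parabolic_root_system = based_root_system \<Phi> \<Delta>
  for \<Phi> \<Delta> :: "'a::euclidean_space set" +
  fixes \<Delta>' :: "'a set"
  assumes subset_simple: "\<Delta>' \<subseteq> \<Delta>"
begin

abbreviation R :: "'a set" where "R \<equiv> parabolic_radical \<Phi> \<Delta> \<Delta>'"
abbreviation P :: "'a set" where "P \<equiv> standard_parabolic \<Phi> \<Delta> \<Delta>'"
abbreviation ext :: "'a set \<Rightarrow> 'a set" where "ext \<equiv> biclosed_extension \<Phi> \<Delta> \<Delta>'"

lemma subsystem_iff: "\<alpha> \<in> root_subsystem \<Phi> \<Delta>' \<longleftrightarrow> \<alpha> \<in> \<Phi> \<and> (\<forall>\<delta>\<in>\<Delta> - \<Delta>'. coef \<delta> \<alpha> = 0)"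
  using coef_span_iff[OF subset_simple] by (auto simp: root_subsystem_def)

text \<open>A single positive coordinate outside \<open>\<Delta>'\<close> both makes the root
  positive and keeps it out of the subsystem.\<close>

lemma radical_iff: "\<alpha> \<in> R \<longleftrightarrow> \<alpha> \<in> \<Phi> \<and> (\<exists>\<delta>\<in>\<Delta> - \<Delta>'. coef \<delta> \<alpha> > 0)"
proof
  assume "\<alpha> \<in> R"
  then have "\<alpha> \<in> pos" "\<alpha> \<notin> root_subsystem \<Phi> \<Delta>'" by (auto simp: parabolic_radical_def)
  moreover from this obtain \<delta> where "\<delta> \<in> \<Delta> - \<Delta>'" "coef \<delta> \<alpha> \<noteq> 0"
    using pos_root unfolding subsystem_iff by blast
  ultimately show "\<alpha> \<in> \<Phi> \<and> (\<exists>\<delta>\<in>\<Delta> - \<Delta>'. coef \<delta> \<alpha> > 0)"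
    using pos_root coef_pos_nonneg[of \<alpha> \<delta>] by (metis DiffD1 less_eq_real_def)
next
  assume "\<alpha> \<in> \<Phi> \<and> (\<exists>\<delta>\<in>\<Delta> - \<Delta>'. coef \<delta> \<alpha> > 0)"
  then obtain \<delta> where \<delta>: "\<alpha> \<in> \<Phi>" "\<delta> \<in> \<Delta> - \<Delta>'" "coef \<delta> \<alpha> > 0" by blast
  then have "\<alpha> \<in> pos" using posI by blast
  moreover have "\<alpha> \<notin> root_subsystem \<Phi> \<Delta>'"
    unfolding subsystem_iff using \<delta> by (metis less_irrefl)
  ultimately show "\<alpha> \<in> R" by (simp add: parabolic_radical_def)
qed

lemma radical_pos: "\<alpha> \<in> R \<Longrightarrow> \<alpha> \<in> pos"
  by (simp add: parabolic_radical_def)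

lemma radical_subset: "R \<subseteq> P"
  by (auto simp: parabolic_radical_def standard_parabolic_def)

text \<open>The subsystem is symmetric under negation, so the roots missing from P are exactly the
  negatives of R.\<close>

lemma parabolic_iff: "\<alpha> \<in> P \<longleftrightarrow> \<alpha> \<in> \<Phi> \<and> - \<alpha> \<notin> R"
proof (cases "\<alpha> \<in> \<Phi>")
  case True
  have "- \<alpha> \<in> root_subsystem \<Phi> \<Delta>' \<longleftrightarrow> \<alpha> \<in> root_subsystem \<Phi> \<Delta>'"
    by (simp add: subsystem_iff coef_simps)
  then show ?thesis
    using True uminus_pos_iff[OF True] by (auto simp: standard_parabolic_def parabolic_radical_def)
next
  case False
  then show ?thesis
    using pos_root by (auto simp: standard_parabolic_def root_subsystem_def)
qed

lemma closed_radical: "root_closed \<Phi> R"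
  unfolding root_closed_def
proof (intro conjI ballI impI)
  show "R \<subseteq> \<Phi>" by (auto simp: radical_iff)
  fix \<alpha> \<beta> assume *: "\<alpha> \<in> R" "\<beta> \<in> R" "\<alpha> + \<beta> \<in> \<Phi>"
  then obtain \<delta> where \<delta>: "\<delta> \<in> \<Delta> - \<Delta>'" "coef \<delta> \<alpha> > 0" by (auto simp: radical_iff)
  then have "coef \<delta> (\<alpha> + \<beta>) > 0"
    using coef_pos_nonneg[OF radical_pos[OF *(2)], of \<delta>] by (simp add: coef_simps)
  then show "\<alpha> + \<beta> \<in> R" using * \<delta> by (auto simp: radical_iff)
qed

text \<open>P consists of the roots whose coordinates outside \<open>\<Delta>'\<close> are all
  nonnegative.\<close>

lemma closed_parabolic: "root_closed \<Phi> P"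
  unfolding root_closed_def
proof (intro conjI ballI impI)
  show "P \<subseteq> \<Phi>" by (auto simp: parabolic_iff)
  fix \<alpha> \<beta> assume *: "\<alpha> \<in> P" "\<beta> \<in> P" and sum: "\<alpha> + \<beta> \<in> \<Phi>"
  have nonneg: "coef \<delta> \<gamma> \<ge> 0" if "\<gamma> \<in> P" "\<delta> \<in> \<Delta> - \<Delta>'" for \<gamma> \<delta>
    using that unfolding parabolic_iff radical_iff uminus_root_iff coef_simps
    by (meson neg_0_less_iff_less not_le)
  have "\<not> coef \<delta> (- (\<alpha> + \<beta>)) > 0" if "\<delta> \<in> \<Delta> - \<Delta>'" for \<delta>
    using nonneg[OF *(1) that] nonneg[OF *(2) that] by (simp add: coef_simps)
  then show "\<alpha> + \<beta> \<in> P" using sum unfolding parabolic_iff radical_iff by blast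
qed

section \<open>The extension map and its inverse\<close>

lemma ext_iff:
  assumes "C \<subseteq> P"
  shows "\<alpha> \<in> ext C \<longleftrightarrow> \<alpha> \<in> C \<or> - \<alpha> \<in> R \<and> - \<alpha> \<notin> C"
proof -
  have "P = root_subsystem \<Phi> \<Delta>' \<union> R"
    by (auto simp: standard_parabolic_def parabolic_radical_def)
  then have "ext C = C \<union> uminus ` (R - C)"
    using assms by (auto simp: biclosed_extension_def)
  then show ?thesis by (force simp: image_iff)
qed

lemma ext_Int_parabolic: "C \<subseteq> P \<Longrightarrow> ext C \<inter> P = C"
  by (auto simp: ext_iff parabolic_iff)

text \<open>Extension commutes with complements. Closedness of the complement of
  \<open>ext C\<close> therefore reduces to closedness of an extension, as P - C is biclosed along
  with C.\<close>

lemma Diff_ext: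
  assumes "C \<subseteq> P"
  shows "\<Phi> - ext C = ext (P - C)"
proof (rule Set.set_eqI)
  fix \<alpha>
  have "P - C \<subseteq> P" by blast
  then show "\<alpha> \<in> \<Phi> - ext C \<longleftrightarrow> \<alpha> \<in> ext (P - C)"
    using assms radical_subset radical_iff[of "- \<alpha>"] parabolic_iff[of \<alpha>]
    unfolding Diff_iff ext_iff[OF assms] ext_iff[OF \<open>P - C \<subseteq> P\<close>] uminus_root_iff by blast
qed

lemma closed_ext:
  assumes C: "biclosed_in \<Phi> P C"
  shows "root_closed \<Phi> (ext C)"
  unfolding root_closed_def
proof (intro conjI ballI impI)
  have sub: "C \<subseteq> P"
    and add: "\<And>\<alpha> \<beta>. \<alpha> \<in> C \<Longrightarrow> \<beta> \<in> C \<Longrightarrow> \<alpha> + \<beta> \<in> \<Phi> \<Longrightarrow> \<alpha> + \<beta> \<in> C"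
    and add': "\<And>\<alpha> \<beta>. \<alpha> \<in> P - C \<Longrightarrow> \<beta> \<in> P - C \<Longrightarrow> \<alpha> + \<beta> \<in> \<Phi> \<Longrightarrow> \<alpha> + \<beta> \<in> P - C"
    using C unfolding biclosed_in_def root_closed_def by blast+
  note ext = ext_iff[OF sub]
  have C\<Phi>: "C \<subseteq> \<Phi>" using sub parabolic_iff by blast
  show "ext C \<subseteq> \<Phi>"
  proof
    fix \<alpha> assume "\<alpha> \<in> ext C"
    then show "\<alpha> \<in> \<Phi>" using C\<Phi> radical_iff[of "- \<alpha>"] unfolding ext uminus_root_iff by blast
  qed
  \<comment> \<open>If the sum is in P but not in C, adding -\<beta> puts \<alpha> into P - C. If it
    is not in P, its negative is in R, and were that in C, adding \<alpha> would put -\<beta> into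
    C.\<close>
  have mixed: "\<alpha> + \<beta> \<in> ext C"
    if \<alpha>: "\<alpha> \<in> C" and \<beta>: "- \<beta> \<in> R" "- \<beta> \<notin> C" and sum: "\<alpha> + \<beta> \<in> \<Phi>" for \<alpha> \<beta>
  proof (cases "\<alpha> + \<beta> \<in> P")
    case True
    have "\<alpha> + \<beta> \<in> C"
    proof (rule ccontr)
      assume "\<alpha> + \<beta> \<notin> C"
      with True have "(\<alpha> + \<beta>) + - \<beta> \<in> P - C"
        using \<beta> \<alpha> C\<Phi> radical_subset by (intro add'[of "\<alpha> + \<beta>" "- \<beta>"]) auto
      then show False using \<alpha> by simp
    qed
    then show ?thesis unfolding ext by blast
  next
    case False
    then have "- (\<alpha> + \<beta>) \<in> R" using sum unfolding parabolic_iff by blast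
    moreover have "- (\<alpha> + \<beta>) \<notin> C"
    proof
      assume "- (\<alpha> + \<beta>) \<in> C"
      moreover have "\<alpha> + - (\<alpha> + \<beta>) = - \<beta>" by simp
      ultimately show False using add[of \<alpha> "- (\<alpha> + \<beta>)"] \<alpha> \<beta> by (auto simp: radical_iff)
    qed
    ultimately show ?thesis unfolding ext by blast
  qed
  fix \<alpha> \<beta> assume *: "\<alpha> \<in> ext C" "\<beta> \<in> ext C" and sum: "\<alpha> + \<beta> \<in> \<Phi>"
  consider "\<alpha> \<in> C" "\<beta> \<in> C" | "\<alpha> \<in> C" "- \<beta> \<in> R" "- \<beta> \<notin> C" | "\<beta> \<in> C" "- \<alpha> \<in> R" "- \<alpha> \<notin> C"
    | "- \<alpha> \<in> R" "- \<alpha> \<notin> C" "- \<beta> \<in> R" "- \<beta> \<notin> C"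
    using * unfolding ext by blast
  then show "\<alpha> + \<beta> \<in> ext C"
  proof cases
    case 1
    then show ?thesis using add sum unfolding ext by blast
  next
    case 2
    then show ?thesis using mixed sum by blast
  next
    case 3
    then show ?thesis using mixed[of \<beta> \<alpha>] sum by (simp add: add.commute)
  next
    case 4
    have "- (\<alpha> + \<beta>) \<in> \<Phi>" using sum by (simp only: uminus_root_iff)
    then have neg: "- \<alpha> + - \<beta> \<in> \<Phi>" by simp
    \<comment> \<open>Two closures are combined: that of P - C keeps the negated sum outside C, that
      of R keeps it in the radical.\<close>
    have "- \<alpha> + - \<beta> \<in> P - C" using 4 radical_subset neg by (intro add') auto
    moreover have "- \<alpha> + - \<beta> \<in> R" using closed_radical 4 neg unfolding root_closed_def by blast
    ultimately have "- (\<alpha> + \<beta>) \<in> R" "- (\<alpha> + \<beta>) \<notin> C" by simp_all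
    then show ?thesis unfolding ext by blast
  qed
qed

lemma biclosed_ext:
  assumes C: "biclosed_in \<Phi> P C"
  shows "biclosed_in \<Phi> \<Phi> (ext C)"
proof -
  have sub: "C \<subseteq> P" using C by (simp add: biclosed_in_def)
  then have "P - (P - C) = C" by blast
  then have "biclosed_in \<Phi> P (P - C)" using C by (auto simp: biclosed_in_def)
  then have "root_closed \<Phi> (\<Phi> - ext C)" using closed_ext by (simp only: Diff_ext[OF sub])
  then show ?thesis using closed_ext[OF C] by (auto simp: biclosed_in_def root_closed_def)
qed

text \<open>For each root of R the extension contains exactly one of the two signs, so the roots
  whose reflections generate the stabilizer all lie in the subsystem.\<close>

lemma stabilizer_ext:
  assumes C: "biclosed_in \<Phi> P C"
  shows "set_stabilizer \<Phi> (ext C) \<subseteq> parabolic_subgroup \<Delta>'"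
proof -
  let ?\<Psi> = "{\<alpha> \<in> \<Phi>. \<alpha> \<in> ext C \<longleftrightarrow> - \<alpha> \<in> ext C}"
  have sub: "C \<subseteq> P" using C by (simp add: biclosed_in_def)
  have R: "- \<alpha> \<in> ext C \<longleftrightarrow> \<alpha> \<notin> ext C" if "\<alpha> \<in> R" for \<alpha>
  proof -
    have "- \<alpha> \<notin> P" "\<alpha> \<in> P" using that radical_subset by (auto simp: parabolic_iff)
    then show ?thesis using that sub by (auto simp: ext_iff[OF sub] parabolic_iff)
  qed
  have "reflection \<alpha> \<in> parabolic_subgroup \<Delta>'" if "\<alpha> \<in> ?\<Psi>" for \<alpha>
  proof (rule reflection_in_parabolic[OF subset_simple])
    show "\<alpha> \<in> \<Phi>" using that by blast
    have "\<alpha> \<notin> R" "- \<alpha> \<notin> R" using that R[of \<alpha>] R[of "- \<alpha>"] by auto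
    then have "\<alpha> \<in> root_subsystem \<Phi> \<Delta>'"
      using that parabolic_iff[of \<alpha>] by (auto simp: standard_parabolic_def parabolic_radical_def)
    then show "\<alpha> \<in> span \<Delta>'" by (simp add: root_subsystem_def)
  qed
  then have "reflection_group ?\<Psi> \<subseteq> parabolic_subgroup \<Delta>'"
    by (intro reflection_group_subset) blast
  then show ?thesis
    using set_stabilizer_subset[OF simple_system biclosed_ext[OF C]] by (rule order_trans[rotated])
qed

lemma biclosed_Int_parabolic:
  assumes F: "biclosed_in \<Phi> \<Phi> F"
  shows "biclosed_in \<Phi> P (F \<inter> P)"
proof -
  have *: "root_closed \<Phi> (A \<inter> P)" if "root_closed \<Phi> A" for A
    using that closed_parabolic unfolding root_closed_def by blast
  have "P - F \<inter> P = (\<Phi> - F) \<inter> P" using parabolic_iff by blast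
  then show ?thesis using F *[of F] *[of "\<Phi> - F"] by (simp add: biclosed_in_def)
qed

text \<open>If F treated both signs of some \<alpha> in R alike, the reflection in \<alpha> would
  stabilize F, forcing \<alpha> into the span of \<open>\<Delta>'\<close>. Hence F on the negatives
  of R is determined by F on R.\<close>

lemma ext_Int:
  assumes F: "biclosed_in \<Phi> \<Phi> F" and stab: "set_stabilizer \<Phi> F \<subseteq> parabolic_subgroup \<Delta>'"
  shows "ext (F \<inter> P) = F"
proof -
  have R: "- \<alpha> \<in> F \<longleftrightarrow> \<alpha> \<notin> F" if "\<alpha> \<in> R" for \<alpha>
  proof (rule ccontr)
    assume no: "\<not> ?thesis"
    have \<alpha>: "\<alpha> \<in> \<Phi>" using that by (simp add: radical_iff)
    then have "reflection \<alpha> \<in> set_stabilizer \<Phi> F"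
      using reflection_biclosed_set[OF F \<alpha>] no reflection_in_group
      by (auto simp: set_stabilizer_def)
    then have "\<alpha> \<in> span \<Delta>'" using stab root_in_span_if_reflection_in_group by blast
    then show False using that \<alpha> by (simp add: parabolic_radical_def root_subsystem_def)
  qed
  have F\<Phi>: "F \<subseteq> \<Phi>" using F by (simp add: biclosed_in_def)
  show ?thesis
  proof (rule Set.set_eqI)
    fix \<alpha>
    have "\<alpha> \<in> ext (F \<inter> P) \<longleftrightarrow> \<alpha> \<in> F \<and> \<alpha> \<in> P \<or> - \<alpha> \<in> R \<and> - \<alpha> \<notin> F"
      using radical_subset by (auto simp: ext_iff)
    also have "\<dots> \<longleftrightarrow> \<alpha> \<in> F"
      using R[of "- \<alpha>"] F\<Phi> parabolic_iff[of \<alpha>] by auto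
    finally show "\<alpha> \<in> ext (F \<inter> P) \<longleftrightarrow> \<alpha> \<in> F" .
  qed
qed

end

theorem lemma4p1:
  fixes \<Phi> \<Delta> \<Delta>\<^sub>2 :: "'a::euclidean_space set"
  assumes "irreducible_root_system \<Phi>"
    and "simple_system \<Phi> \<Delta>"
    and "\<Delta>\<^sub>2 \<subseteq> \<Delta>"
  shows "bij_betw (\<lambda>C. biclosed_extension \<Phi> \<Delta> \<Delta>\<^sub>2 C)
           {C. biclosed_in \<Phi> (standard_parabolic \<Phi> \<Delta> \<Delta>\<^sub>2) C}
           {F. biclosed_in \<Phi> \<Phi> F \<and> set_stabilizer \<Phi> F \<subseteq> parabolic_subgroup \<Delta>\<^sub>2}
       \<and> bij_betw (\<lambda>F. F \<inter> standard_parabolic \<Phi> \<Delta> \<Delta>\<^sub>2)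
           {F. biclosed_in \<Phi> \<Phi> F \<and> set_stabilizer \<Phi> F \<subseteq> parabolic_subgroup \<Delta>\<^sub>2}
           {C. biclosed_in \<Phi> (standard_parabolic \<Phi> \<Delta> \<Delta>\<^sub>2) C}
       \<and> (\<forall>C. biclosed_in \<Phi> (standard_parabolic \<Phi> \<Delta> \<Delta>\<^sub>2) C \<longrightarrow>
            biclosed_extension \<Phi> \<Delta> \<Delta>\<^sub>2 C \<inter> standard_parabolic \<Phi> \<Delta> \<Delta>\<^sub>2 = C)
       \<and> (\<forall>F. biclosed_in \<Phi> \<Phi> F \<and> set_stabilizer \<Phi> F \<subseteq> parabolic_subgroup \<Delta>\<^sub>2 \<longrightarrow>
            biclosed_extension \<Phi> \<Delta> \<Delta>\<^sub>2 (F \<inter> standard_parabolic \<Phi> \<Delta> \<Delta>\<^sub>2) = F)"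
proof -
  interpret parabolic_root_system \<Phi> \<Delta> \<Delta>\<^sub>2
    using assms by unfold_locales (simp_all add: irreducible_root_system_def)
  let ?A = "{C. biclosed_in \<Phi> P C}"
  let ?B = "{F. biclosed_in \<Phi> \<Phi> F \<and> set_stabilizer \<Phi> F \<subseteq> parabolic_subgroup \<Delta>\<^sub>2}"
  have l: "\<forall>C\<in>?A. ext C \<inter> P = C"
    using ext_Int_parabolic by (simp add: biclosed_in_def)
  have r: "\<forall>F\<in>?B. ext (F \<inter> P) = F"
    using ext_Int by blast
  have AB: "ext ` ?A \<subseteq> ?B"
    using biclosed_ext stabilizer_ext by blast
  have BA: "(\<lambda>F. F \<inter> P) ` ?B \<subseteq> ?A"
    using biclosed_Int_parabolic by blast
  \<comment> \<open>Each map serves as the inverse witness for the other.\<close>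
  show ?thesis
    using bij_betw_byWitness[OF l r AB BA] bij_betw_byWitness[OF r l BA AB] l r by simp
qed

end
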